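(* Let $X$ be a Hausdorff space with a countable $k$-network and let $\mathcal I$ be a discretely-complete ideal of compact subsets of $X$. Then for any topological space $Y$ with a countable Pytkeev network, the function space $C_{\mathcal I}(X,Y)$ has a countable Pytkeev network.
   Context: Compactness does not include any separation axiom. A subset $A$ of a topological space $X$ accumulates at a point $x\in X$ if each neighborhood of $x$ contains infinitely many points of $A$. A family $\mathcal N$ of subsets of $X$ is a network at $x\in X$ if for any neighborhood $O_x$ of $x$ there is $N\in\mathcal N$ with $x\in N\subset O_x$. It is a Pytkeev network at $x$ if it is a network at $x$ and for each neighborhood $O_x$ of $x$ and each subset $A\subset X$ accumulating at $x$ there is $N\in\mathcal N$ such that $N\subset O_x$ and $N\cap A$ is infinite. It is a Pytkeev network for $X$ if it is a Pytkeev network at each point $x\in X$. A family $\mathcal N$ of subsets of $X$ is a $k$-network if for each open set $U\subset X$ and each compact subset $K\subset U$ there is a finite subfamily $\mathcal F\subset\mathcal N$ such that $K\subset\bigcup\mathcal F\subset U$. A family $\mathcal I$ of compact subsets of $X$ is an ideal of compact sets if $\bigcup\mathcal I=X$ and for any $A,B\in\mathcal I$ and any compact subset $K\subset X$ we have $A\cup B\in\mathcal I$ and $A\cap K\in\mathcal I$. An ideal $\mathcal I$ of compact subsets of $X$ is discretely-complete if for any compact subsets $A,B\subset X$ such that $A\setminus B$ is a countable discrete subspace of $X$, the inclusion $B\in\mathcal I$ implies $A\in\mathcal I$. $C_{\mathcal I}(X,Y)$ denotes the set $C(X,Y)$ of all continuous functions from $X$ to $Y$ endowed with the $\mathcal I$-open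 topology, i.e. the topology generated by the subbase consisting of the sets $[K;U]=\{f\in C(X,Y): f(K)\subset U\}$, where $K\in\mathcal I$ and $U$ is an open subset of $Y$. *)

theory Defs
  imports "HOL-Analysis.Analysis"
begin

definition nbhd_in :: "'a topology \<Rightarrow> 'a \<Rightarrow> 'a set \<Rightarrow> bool" where
  "nbhd_in X x N \<longleftrightarrow> N \<subseteq> topspace X \<and> (\<exists>U. openin X U \<and> x \<in> U \<and> U \<subseteq> N)"

definition accumulates_at :: "'a topology \<Rightarrow> 'a set \<Rightarrow> 'a \<Rightarrow> bool" where
  "accumulates_at X A x \<longleftrightarrow>
     A \<subseteq> topspace X \<and> x \<in> topspace X \<and> (\<forall>V. nbhd_in X x V \<longrightarrow> infinite (V \<inter> A))"

definition network_at :: "'a topology \<Rightarrow> 'a set set \<Rightarrow> 'a \<Rightarrow> bool" where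
  "network_at X \<N> x \<longleftrightarrow>
     \<N> \<subseteq> Pow (topspace X) \<and> x \<in> topspace X \<and>
     (\<forall>V. nbhd_in X x V \<longrightarrow> (\<exists>N\<in>\<N>. x \<in> N \<and> N \<subseteq> V))"

definition pytkeev_network_at :: "'a topology \<Rightarrow> 'a set set \<Rightarrow> 'a \<Rightarrow> bool" where
  "pytkeev_network_at X \<N> x \<longleftrightarrow>
     network_at X \<N> x \<and>
     (\<forall>V A. nbhd_in X x V \<and> accumulates_at X A x \<longrightarrow>
        (\<exists>N\<in>\<N>. N \<subseteq> V \<and> infinite (N \<inter> A)))"

definition pytkeev_network :: "'a topology \<Rightarrow> 'a set set \<Rightarrow> bool" where
  "pytkeev_network X \<N> \<longleftrightarrow>
     \<N> \<subseteq> Pow (topspace X) \<and> (\<forall>x\<in>topspace X. pytkeev_network_at X \<N> x)"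

definition k_network :: "'a topology \<Rightarrow> 'a set set \<Rightarrow> bool" where
  "k_network X \<N> \<longleftrightarrow>
     \<N> \<subseteq> Pow (topspace X) \<and>
     (\<forall>U K. openin X U \<and> compactin X K \<and> K \<subseteq> U \<longrightarrow>
        (\<exists>\<F>. finite \<F> \<and> \<F> \<subseteq> \<N> \<and> K \<subseteq> \<Union>\<F> \<and> \<Union>\<F> \<subseteq> U))"

definition compact_ideal :: "'a topology \<Rightarrow> 'a set set \<Rightarrow> bool" where
  "compact_ideal X \<I> \<longleftrightarrow>
     (\<forall>A\<in>\<I>. compactin X A) \<and> \<Union>\<I> = topspace X \<and>
     (\<forall>A\<in>\<I>. \<forall>B\<in>\<I>. \<forall>K. compactin X K \<longrightarrow> A \<union> B \<in> \<I> \<and> A \<inter> K \<in> \<I>)"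

text \<open>Countable includes finite.\<close>

definition discretely_complete :: "'a topology \<Rightarrow> 'a set set \<Rightarrow> bool" where
  "discretely_complete X \<I> \<longleftrightarrow>
     (\<forall>A B. compactin X A \<and> compactin X B \<and> countable (A - B) \<and>
            subtopology X (A - B) = discrete_topology (A - B) \<and> B \<in> \<I> \<longrightarrow> A \<in> \<I>)"

text \<open>Continuous maps are normalised to be \<^const>\<open>extensional\<close> on the carrier of \<^term>\<open>X\<close>, so that
  each continuous function between the two spaces is represented by exactly one HOL function.\<close>

definition cont_maps :: "'a topology \<Rightarrow> 'b topology \<Rightarrow> ('a \<Rightarrow> 'b) set" where
  "cont_maps X Y = {f \<in> extensional (topspace X). continuous_map X Y f}"

definition subbasic :: "'a topology \<Rightarrow> 'b topology \<Rightarrow> 'a set \<Rightarrow> 'b set \<Rightarrow> ('a \<Rightarrow> 'b) set" where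
  "subbasic X Y K U = {f \<in> cont_maps X Y. f ` K \<subseteq> U}"

text \<open>\<^const>\<open>topology_generated_by\<close> takes the union of the subbase as the carrier, whereas by the usual
  convention the empty intersection is the whole set. Inserting \<^term>\<open>cont_maps X Y\<close> only matters
  when \<^term>\<open>\<I>\<close> is empty (hence \<^term>\<open>X\<close> is empty).\<close>

definition ideal_open_topology ::
  "'a topology \<Rightarrow> 'a set set \<Rightarrow> 'b topology \<Rightarrow> ('a \<Rightarrow> 'b) topology" where
  "ideal_open_topology X \<I> Y =
     topology_generated_by
       (insert (cont_maps X Y) {subbasic X Y K U |K U. K \<in> \<I> \<and> openin Y U})"

lemma topspace_ideal_open_topology [simp]:
  "topspace (ideal_open_topology X \<I> Y) = cont_maps X Y"
  by (auto simp: ideal_open_topology_def subbasic_def)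

end

theory Submission
  imports Defs
begin

text \<open>
  The network consists of the finite intersections of sets
  \<open>[K; P] = {g. g ` K \<subseteq> P}\<close>, where \<open>K\<close> is built from a countable \<open>k\<close>-network of \<open>X\<close> by finite
  unions and intersections, and \<open>P\<close> from a countable Pytkeev network of \<open>Y\<close> by finite unions.

  Let \<open>[C\<^sub>1; U\<^sub>1] \<inter> \<dots> \<inter> [C\<^sub>m; U\<^sub>m]\<close> be a basic neighbourhood of \<open>f\<close>. Each \<open>C\<^sub>i\<close> is the limit of a
  decreasing sequence of sets \<open>K i j \<subseteq> f\<^sup>-\<^sup>1 U\<^sub>i\<close> (lemma \<open>outer_approximation\<close>), and the members of the
  Pytkeev network inside \<open>U\<^sub>i\<close> are exhausted by an increasing sequence \<open>P i j\<close>
  (lemma \<open>inner_approximation\<close>). So \<open>F j = \<Inter>i. [K i j; P i j]\<close> is an increasing sequence of members of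
  the network inside the given neighbourhood. The heart of the proof
  (lemma \<open>frequently_in_network_box\<close>) is that whenever a sequence \<open>\<alpha>\<close> in the function space enters every
  neighbourhood of \<open>f\<close> infinitely often, some \<open>F j\<close> contains \<open>\<alpha> n\<close> for infinitely many \<open>n\<close>.

  Suppose not. Then for all large \<open>n\<close> we have \<open>\<alpha> n \<notin> F (J n)\<close> with \<open>J n \<rightarrow> \<infinity>\<close>
  (lemma \<open>diagonal_index\<close>), and this is witnessed by an index \<open>i = \<sigma> n\<close> and a point
  \<open>x n \<in> K i (J n)\<close> with \<open>\<alpha> n (x n) \<notin> P i (J n)\<close>. The points \<open>x n\<close> with \<open>\<sigma> n = i\<close> converge to \<open>C\<^sub>i\<close>.
  Therefore adding them to \<open>C\<^sub>i\<close> gives a compact set that exceeds \<open>C\<^sub>i\<close> by a countable discrete set, and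
  discrete completeness puts this set \<open>D\<^sub>i\<close> in \<open>\<I>\<close> (lemma \<open>Un_convergent_in_ideal\<close>). By construction a member of
  the Pytkeev network inside \<open>U\<^sub>i\<close> contains only finitely many of the values \<open>\<alpha> n (x n)\<close>, so these
  values cannot accumulate at a point of \<open>U\<^sub>i\<close> (lemma \<open>pytkeev_avoiding_sequence\<close>). Hence each point of
  \<open>f ` D\<^sub>i\<close> has a neighbourhood that contains \<open>\<alpha> n (x n)\<close> for finitely many \<open>n\<close> only, and a finite
  cover of \<open>D\<^sub>i\<close> by compact pieces, each mapped by \<open>f\<close> into one such neighbourhood, defines a
  neighbourhood of \<open>f\<close> that contains only finitely many of these \<open>\<alpha> n\<close> (lemma \<open>separating_box\<close>).
  Intersecting over the finitely many \<open>i\<close> contradicts the assumption on \<open>\<alpha>\<close>.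

  The constant sequence \<open>\<alpha> n = f\<close> yields the network property. For the Pytkeev property, a countable
  network makes it possible to replace a set accumulating at \<open>f\<close> by a countable subset
  (lemma \<open>accumulates_at_countable_subset\<close>), and an injective enumeration of the latter serves as \<open>\<alpha>\<close>.
\<close>

section \<open>Boxes in the function space\<close>

text \<open>
  The same construction serves for basic open sets of the function space, where the pairs are
  a member of \<open>\<I>\<close> and an open set, and for members of the network, where neither set need be
  compact or open. The empty \<open>S\<close> gives the whole function space.
\<close>

definition box_maps :: "'a topology \<Rightarrow> 'b topology \<Rightarrow> ('a set \<times> 'b set) set \<Rightarrow> ('a \<Rightarrow> 'b) set" where
  "box_maps X Y S = {f \<in> cont_maps X Y. \<forall>s\<in>S. f ` fst s \<subseteq> snd s}"

lemma box_maps_Un: "box_maps X Y (S \<union> T) = box_maps X Y S \<inter> box_maps X Y T"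
  by (auto simp: box_maps_def)

lemma box_maps_subset: "box_maps X Y S \<subseteq> cont_maps X Y"
  by (auto simp: box_maps_def)

lemma openin_box_maps:
  assumes "finite S" "S \<subseteq> \<I> \<times> Collect (openin Y)"
  shows "openin (ideal_open_topology X \<I> Y) (box_maps X Y S)"
  using assms
proof (induction S)
  case empty
  have "openin (ideal_open_topology X \<I> Y) (cont_maps X Y)"
    unfolding ideal_open_topology_def by (rule topology_generated_by_Basis) auto
  then show ?case by (simp add: box_maps_def)
next
  case (insert s S)
  obtain K U where s: "s = (K, U)" "K \<in> \<I>" "openin Y U" using insert.prems by auto
  have "openin (ideal_open_topology X \<I> Y) (subbasic X Y K U)"
    unfolding ideal_open_topology_def by (rule topology_generated_by_Basis) (use s in auto)
  moreover have "box_maps X Y (insert s S) = subbasic X Y K U \<inter> box_maps X Y S"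
    by (auto simp: box_maps_def subbasic_def s)
  ultimately show ?case using insert by auto
qed

lemma ideal_open_nbhd_base:
  assumes "openin (ideal_open_topology X \<I> Y) W" "f \<in> W"
  shows "\<exists>S. finite S \<and> S \<subseteq> \<I> \<times> Collect (openin Y) \<and> f \<in> box_maps X Y S \<and> box_maps X Y S \<subseteq> W"
proof -
  have "generate_topology_on
          (insert (cont_maps X Y) {subbasic X Y K U |K U. K \<in> \<I> \<and> openin Y U}) W"
    using assms(1) unfolding ideal_open_topology_def by (rule openin_topology_generated_by)
  then show ?thesis using assms(2)
  proof (induction W)
    case (Int a b)
    obtain S where S: "finite S" "S \<subseteq> \<I> \<times> Collect (openin Y)"
        "f \<in> box_maps X Y S" "box_maps X Y S \<subseteq> a"
      using Int.IH(1) Int.prems by auto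
    obtain T where T: "finite T" "T \<subseteq> \<I> \<times> Collect (openin Y)"
        "f \<in> box_maps X Y T" "box_maps X Y T \<subseteq> b"
      using Int.IH(2) Int.prems by auto
    show ?case using S T by (intro exI[of _ "S \<union> T"]) (auto simp: box_maps_Un)
  next
    case (UN \<K>)
    then obtain k where k: "k \<in> \<K>" "f \<in> k" by blast
    from UN.IH[OF this] show ?case using k(1) by (meson Sup_upper subset_trans)
  next
    case (Basis s)
    then consider "s = cont_maps X Y" | K U where "s = subbasic X Y K U" "K \<in> \<I>" "openin Y U"
      by blast
    then show ?case
    proof cases
      case 1
      then show ?thesis using Basis by (intro exI[of _ "{}"]) (auto simp: box_maps_def)
    next
      case 2
      then show ?thesis using Basis
        by (intro exI[of _ "{(K, U)}"]) (auto simp: box_maps_def subbasic_def)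
    qed
  qed auto
qed

section \<open>Approximating compact sets from outside and open sets from inside\<close>

definition finite_unions :: "'a set set \<Rightarrow> 'a set set" where
  "finite_unions \<N> = Union ` {\<F>. finite \<F> \<and> \<F> \<subseteq> \<N>}"

definition finite_inters :: "'a set set \<Rightarrow> 'a set set" where
  "finite_inters \<N> = Inter ` {\<F>. finite \<F> \<and> \<F> \<subseteq> \<N>}"

lemma countable_finite_unions: "countable \<N> \<Longrightarrow> countable (finite_unions \<N>)"
  unfolding finite_unions_def by (intro countable_image countable_Collect_finite_subset)

lemma countable_finite_inters: "countable \<N> \<Longrightarrow> countable (finite_inters \<N>)"
  unfolding finite_inters_def by (intro countable_image countable_Collect_finite_subset)

text \<open>
  The finite unions of members of the \<open>k\<close>-network that lie between \<open>C\<close> and \<open>G\<close> form a countable family,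
  and every open set around \<open>C\<close> contains one of them. The intersections of initial segments of an
  enumeration turn it into a decreasing sequence, which is eventually inside each of them.
\<close>

lemma outer_approximation:
  assumes kn: "k_network X \<N>" "countable \<N>" and C: "compactin X C" and G: "openin X G" "C \<subseteq> G"
  obtains K :: "nat \<Rightarrow> 'a set" where "range K \<subseteq> finite_inters (finite_unions \<N>)"
    "\<And>j. C \<subseteq> K j" "\<And>j. K j \<subseteq> G"
    "\<And>W. \<lbrakk>openin X W; C \<subseteq> W\<rbrakk> \<Longrightarrow> eventually (\<lambda>j. K j \<subseteq> W) sequentially"
proof -
  define \<E> where "\<E> = {N \<in> finite_unions \<N>. C \<subseteq> N \<and> N \<subseteq> G}"
  have ex: "\<exists>N\<in>\<E>. N \<subseteq> W" if W: "openin X W" "C \<subseteq> W" for W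
  proof -
    have "openin X (W \<inter> G)" "C \<subseteq> W \<inter> G" using W G by auto
    then obtain \<F> where "finite \<F>" "\<F> \<subseteq> \<N>" "C \<subseteq> \<Union>\<F>" "\<Union>\<F> \<subseteq> W \<inter> G"
      using kn(1) C unfolding k_network_def by meson
    then show ?thesis unfolding \<E>_def finite_unions_def by (intro bexI[of _ "\<Union>\<F>"]) auto
  qed
  have ne: "\<E> \<noteq> {}" using ex[OF G] by blast
  have "countable \<E>" unfolding \<E>_def using countable_finite_unions[OF kn(2)] by simp
  then have range: "range (from_nat_into \<E>) = \<E>" using ne by simp
  define K where "K = (\<lambda>j. \<Inter> (from_nat_into \<E> ` {..j}))"
  have E: "from_nat_into \<E> i \<in> \<E>" for i using range by blast
  show ?thesis
  proof
    show "range K \<subseteq> finite_inters (finite_unions \<N>)"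
      unfolding K_def finite_inters_def using E by (auto simp: \<E>_def)
    show "C \<subseteq> K j" for j unfolding K_def using E by (auto simp: \<E>_def)
    show "K j \<subseteq> G" for j unfolding K_def using E[of 0] by (auto simp: \<E>_def)
    show "eventually (\<lambda>j. K j \<subseteq> W) sequentially" if W: "openin X W" "C \<subseteq> W" for W
    proof -
      obtain N where "N \<in> \<E>" "N \<subseteq> W" using ex[OF W] by blast
      then obtain i where i: "from_nat_into \<E> i \<subseteq> W" using range by (metis imageE)
      show ?thesis unfolding eventually_sequentially
        by (intro exI[of _ i]) (use i in \<open>auto simp: K_def\<close>)
    qed
  qed
qed

text \<open>
  The dual construction, with unions of initial segments. It is stated for members of \<open>\<P>\<close> rather
  than for points of \<open>U\<close>, because a sequence of values that leaves the sets \<open>P j\<close> then meets each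
  member of \<open>\<P>\<close> inside \<open>U\<close> only finitely often, which is what the Pytkeev property excludes. If
  \<open>U\<close> contains no member of \<open>\<P>\<close>, there is nothing to enumerate and all \<open>P j\<close> are empty.
\<close>

lemma inner_approximation:
  assumes "countable \<P>"
  obtains P :: "nat \<Rightarrow> 'b set" where "range P \<subseteq> finite_unions \<P>" "\<And>j. P j \<subseteq> U"
    "\<And>N. \<lbrakk>N \<in> \<P>; N \<subseteq> U\<rbrakk> \<Longrightarrow> eventually (\<lambda>j. N \<subseteq> P j) sequentially"
proof (cases "\<exists>N\<in>\<P>. N \<subseteq> U")
  case False
  show ?thesis
    by (rule that[of "\<lambda>_. {}"]) (use False in \<open>auto simp: finite_unions_def\<close>)
next
  case True
  define \<E> where "\<E> = {N \<in> \<P>. N \<subseteq> U}"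
  have "\<E> \<noteq> {}" "countable \<E>" using True assms by (auto simp: \<E>_def)
  then have range: "range (from_nat_into \<E>) = \<E>" by simp
  have E: "from_nat_into \<E> i \<in> \<E>" for i using range by blast
  define P where "P = (\<lambda>j. \<Union> (from_nat_into \<E> ` {..j}))"
  show ?thesis
  proof
    show "range P \<subseteq> finite_unions \<P>"
      unfolding P_def finite_unions_def using E by (auto simp: \<E>_def)
    show "P j \<subseteq> U" for j unfolding P_def using E by (auto simp: \<E>_def)
    show "eventually (\<lambda>j. N \<subseteq> P j) sequentially" if "N \<in> \<P>" "N \<subseteq> U" for N
    proof -
      have "N \<in> \<E>" using that by (simp add: \<E>_def)
      then obtain i where i: "from_nat_into \<E> i = N" using range by (metis imageE)
      show ?thesis unfolding eventually_sequentially
        by (intro exI[of _ i]) (use i in \<open>auto simp: P_def\<close>)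
    qed
  qed
qed

section \<open>Sequences converging to a compact set\<close>

text \<open>
  A finite subcover of \<open>C\<close> already covers all but finitely many terms, and each of the remaining terms
  costs one more open set.
\<close>

lemma compactin_Un_convergent:
  assumes C: "compactin X C" and x: "x ` M \<subseteq> topspace X"
    and conv: "\<And>W. \<lbrakk>openin X W; C \<subseteq> W\<rbrakk> \<Longrightarrow> finite {n \<in> M. x n \<notin> W}"
  shows "compactin X (C \<union> x ` M)"
  unfolding compactin_def
proof (intro conjI allI impI)
  show "C \<union> x ` M \<subseteq> topspace X" using compactin_subset_topspace[OF C] x by auto
next
  fix \<U> assume \<U>: "(\<forall>U\<in>\<U>. openin X U) \<and> C \<union> x ` M \<subseteq> \<Union>\<U>"
  then obtain \<F> where \<F>: "finite \<F>" "\<F> \<subseteq> \<U>" "C \<subseteq> \<Union>\<F>"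
    using C unfolding compactin_def by (meson Un_subset_iff)
  then have fin: "finite {n \<in> M. x n \<notin> \<Union>\<F>}" using conv[of "\<Union>\<F>"] \<U> by blast
  have "\<forall>n\<in>M. \<exists>U\<in>\<U>. x n \<in> U" using \<U> by blast
  then obtain g where g: "\<And>n. n \<in> M \<Longrightarrow> g n \<in> \<U> \<and> x n \<in> g n" by metis
  define \<G> where "\<G> = \<F> \<union> g ` {n \<in> M. x n \<notin> \<Union>\<F>}"
  have "x n \<in> \<Union>\<G>" if "n \<in> M" for n using g[OF that] that by (auto simp: \<G>_def)
  moreover have "C \<subseteq> \<Union>\<G>" using \<F>(3) by (auto simp: \<G>_def)
  ultimately have "C \<union> x ` M \<subseteq> \<Union>\<G>" by (simp add: image_subset_iff)
  moreover have "finite \<G>" "\<G> \<subseteq> \<U>" using \<F> fin g by (auto simp: \<G>_def)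
  ultimately show "\<exists>\<F>. finite \<F> \<and> \<F> \<subseteq> \<U> \<and> C \<union> x ` M \<subseteq> \<Union>\<F>" by blast
qed

text \<open>
  A point \<open>x m\<close> outside \<open>C\<close> can be separated from the compact set \<open>C\<close> by disjoint open sets. The one
  around \<open>C\<close> absorbs almost all terms, so the one around \<open>x m\<close> contains only finitely many of them
  and \<open>x m\<close> is isolated.
\<close>

lemma discrete_Diff_convergent:
  assumes X: "Hausdorff_space X" and C: "compactin X C" and x: "x ` M \<subseteq> topspace X"
    and conv: "\<And>W. \<lbrakk>openin X W; C \<subseteq> W\<rbrakk> \<Longrightarrow> finite {n \<in> M. x n \<notin> W}"
  shows "subtopology X (x ` M - C) = discrete_topology (x ` M - C)"
proof (rule subtopology_eq_discrete_topology, intro conjI)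
  show "x ` M - C \<subseteq> topspace X" using x by blast
  show "(x ` M - C) \<inter> X derived_set_of (x ` M - C) = {}"
  proof (clarsimp simp: disjoint_iff)
    fix m assume m: "m \<in> M" "x m \<notin> C" "x m \<in> X derived_set_of (x ` M - C)"
    have "compactin X {x m}" using x m by auto
    then obtain U W where UW: "openin X U" "openin X W" "x m \<in> U" "C \<subseteq> W" "disjnt U W"
      using Hausdorff_space_compact_sets[THEN iffD1, OF X, rule_format, of "{x m}" C] C m
      by (auto simp: disjnt_def)
    have "t1_space X" using X by (rule Hausdorff_imp_t1_space)
    then have "infinite ((x ` M - C) \<inter> U)"
      using t1_space_derived_set_of_infinite_openin m(3) UW by fastforce
    moreover have "(x ` M - C) \<inter> U \<subseteq> x ` {n \<in> M. x n \<notin> W}"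
      using UW by (auto simp: disjnt_def)
    ultimately show False using conv[OF UW(2,4)] finite_surj by blast
  qed
qed

text \<open>
  This is the only place where discrete completeness enters: it lets the witnesses \<open>x n\<close> be adjoined
  to a member of \<open>\<I>\<close>, so that conditions at these points are visible to the topology of the function
  space.
\<close>

lemma Un_convergent_in_ideal:
  assumes X: "Hausdorff_space X" and I: "compact_ideal X \<I>" "discretely_complete X \<I>"
    and C: "C \<in> \<I>" and x: "x ` M \<subseteq> topspace X" and M: "countable M"
    and conv: "\<And>W. \<lbrakk>openin X W; C \<subseteq> W\<rbrakk> \<Longrightarrow> finite {n \<in> M. x n \<notin> W}"
  shows "C \<union> x ` M \<in> \<I>"
proof -
  have C': "compactin X C" using I C by (auto simp: compact_ideal_def)
  have eq: "(C \<union> x ` M) - C = x ` M - C" by blast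
  show ?thesis
    using I(2) compactin_Un_convergent[OF C' x conv] C' C M
      discrete_Diff_convergent[OF X C' x conv]
    unfolding discretely_complete_def by (metis eq countable_Diff countable_image)
qed

text \<open>
  The topology of the function space is tested on compact sets, so open covers of \<open>D\<close> have to be
  refined by compact pieces. Although \<open>X\<close> need not be regular, its compact subspace \<open>D\<close> is.
\<close>

lemma compact_finite_refinement:
  assumes X: "Hausdorff_space X" and D: "compactin X D"
    and G: "\<And>z. z \<in> D \<Longrightarrow> openin X (G z) \<and> z \<in> G z"
  obtains T E where "finite T" "T \<subseteq> D" "D \<subseteq> (\<Union>t\<in>T. E t)"
    "\<And>t. t \<in> T \<Longrightarrow> compactin X (E t) \<and> E t \<subseteq> G t \<inter> D"
proof -
  let ?D = "subtopology X D"
  have cs: "compact_space ?D" using D by (simp add: compactin_subspace)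
  have "regular_space ?D"
    using cs X Hausdorff_space_subtopology compact_Hausdorff_imp_regular_space by blast
  then have nb: "\<And>W x. openin ?D W \<Longrightarrow> x \<in> W \<Longrightarrow>
      \<exists>U V. openin ?D U \<and> closedin ?D V \<and> x \<in> U \<and> U \<subseteq> V \<and> V \<subseteq> W"
    by (simp add: neighbourhood_base_of flip: neighbourhood_base_of_closedin)
  have "\<exists>U V. openin ?D U \<and> closedin ?D V \<and> z \<in> U \<and> U \<subseteq> V \<and> V \<subseteq> G z \<inter> D" if "z \<in> D" for z
    by (rule nb) (use G[OF that] that in \<open>auto simp: openin_subtopology\<close>)
  then obtain U E where UE: "\<And>z. z \<in> D \<Longrightarrow>
      openin ?D (U z) \<and> closedin ?D (E z) \<and> z \<in> U z \<and> U z \<subseteq> E z \<and> E z \<subseteq> G z \<inter> D"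
    by metis
  have "compactin ?D D" using D by (simp add: compactin_subtopology)
  moreover have "\<forall>V\<in>U ` D. openin ?D V" "D \<subseteq> \<Union>(U ` D)" using UE by auto
  ultimately obtain \<F> where "finite \<F>" "\<F> \<subseteq> U ` D" "D \<subseteq> \<Union>\<F>"
    unfolding compactin_def by meson
  then obtain T where T: "T \<subseteq> D" "finite T" "D \<subseteq> \<Union>(U ` T)"
    by (metis finite_subset_image)
  show ?thesis
  proof
    show "finite T" "T \<subseteq> D" by fact+
    show "D \<subseteq> (\<Union>t\<in>T. E t)" using T UE by blast
    fix t assume "t \<in> T"
    then have "t \<in> D" using T by blast
    then show "compactin X (E t) \<and> E t \<subseteq> G t \<inter> D"
      using UE[of t] closedin_compact_space[OF cs] compactin_subtopology by blast
  qed
qed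

section \<open>Finding a box that meets a sequence infinitely often\<close>

text \<open>
  Otherwise the values of \<open>b\<close> in \<open>U\<close> would accumulate at \<open>y\<close>, and a member of \<open>\<P>\<close> inside \<open>U\<close> would
  contain infinitely many of them. Accumulation is about infinitely many values, whereas the
  conclusion counts indices; the two agree because a value \<open>z \<in> U\<close> taken infinitely often would be
  caught by the member of \<open>\<P>\<close> that the network property provides at \<open>z\<close>.
\<close>

lemma pytkeev_avoiding_sequence:
  assumes P: "pytkeev_network Y \<P>" and U: "openin Y U" "y \<in> U"
    and avoid: "\<And>N. \<lbrakk>N \<in> \<P>; N \<subseteq> U\<rbrakk> \<Longrightarrow> finite {n \<in> M. b n \<in> N}"
  obtains V where "openin Y V" "y \<in> V" "finite {n \<in> M. b n \<in> V}"
proof (rule ccontr)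
  assume no: "\<not> thesis"
  then have inf: "\<And>V. openin Y V \<Longrightarrow> y \<in> V \<Longrightarrow> infinite {n \<in> M. b n \<in> V}"
    using that by blast
  have nbhdU: "nbhd_in Y z U" if "z \<in> U" for z
    using U that openin_subset by (auto simp: nbhd_in_def)
  have fib: "finite {n \<in> M. b n = z}" if z: "z \<in> U" for z
  proof -
    have "z \<in> topspace Y" using z U openin_subset by blast
    then obtain N where "N \<in> \<P>" "z \<in> N" "N \<subseteq> U"
      using P nbhdU[OF z] unfolding pytkeev_network_def pytkeev_network_at_def network_at_def
      by meson
    then show ?thesis by (intro finite_subset[OF _ avoid[of N]]) auto
  qed
  \<comment> \<open>Values outside \<open>U\<close> must be left out: \<open>fib\<close> controls multiplicities only inside \<open>U\<close>.\<close>
  define B where "B = b ` M \<inter> U"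
  have "infinite (V \<inter> B)" if V: "nbhd_in Y y V" for V
  proof
    assume fin: "finite (V \<inter> B)"
    obtain W where W: "openin Y W" "y \<in> W" "W \<subseteq> V" using V by (auto simp: nbhd_in_def)
    have "{n \<in> M. b n \<in> W \<inter> U} \<subseteq> (\<Union>z \<in> V \<inter> B. {n \<in> M. b n = z})"
      using W by (auto simp: B_def)
    moreover have "finite (\<Union>z \<in> V \<inter> B. {n \<in> M. b n = z})"
      using fin fib by (auto simp: B_def)
    ultimately show False
      using inf[of "W \<inter> U"] W U finite_subset by blast
  qed
  then have "accumulates_at Y B y"
    using U openin_subset by (auto simp: accumulates_at_def B_def)
  then obtain N where N: "N \<in> \<P>" "N \<subseteq> U" "infinite (N \<inter> B)"
    using P nbhdU[OF U(2)] openin_subset[OF U(1)] U(2)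
    unfolding pytkeev_network_def pytkeev_network_at_def by (meson subsetD)
  have "N \<inter> B \<subseteq> b ` {n \<in> M. b n \<in> N}" by (auto simp: B_def)
  then show False using N avoid[OF N(1,2)] finite_surj by blast
qed

text \<open>
  Each point of \<open>f ` (C \<union> x ` M)\<close> has a neighbourhood containing \<open>\<alpha> n (x n)\<close> for finitely many \<open>n\<close>. Since
  \<open>C \<union> x ` M\<close> belongs to \<open>\<I>\<close>, finitely many compact pieces of it express this as an open condition
  on functions which \<open>f\<close> satisfies: an \<open>\<alpha> n\<close> in the resulting box sends \<open>x n\<close>, which lies in one of
  the pieces, into a set that contains such values for finitely many \<open>n\<close> only.
\<close>

lemma separating_box:
  assumes X: "Hausdorff_space X" and I: "compact_ideal X \<I>" "discretely_complete X \<I>"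
    and P: "pytkeev_network Y \<P>" and f: "f \<in> cont_maps X Y"
    and C: "C \<in> \<I>" and U: "openin Y U" "f ` C \<subseteq> U"
    and M: "countable M" and x: "x ` M \<subseteq> topspace X" and fx: "\<And>n. n \<in> M \<Longrightarrow> f (x n) \<in> U"
    and conv: "\<And>W. \<lbrakk>openin X W; C \<subseteq> W\<rbrakk> \<Longrightarrow> finite {n \<in> M. x n \<notin> W}"
    and avoid: "\<And>N. \<lbrakk>N \<in> \<P>; N \<subseteq> U\<rbrakk> \<Longrightarrow> finite {n \<in> M. \<alpha> n (x n) \<in> N}"
  shows "\<exists>S. finite S \<and> S \<subseteq> \<I> \<times> Collect (openin Y) \<and> f \<in> box_maps X Y S \<and>
    finite {n \<in> M. \<alpha> n \<in> box_maps X Y S}"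
proof -
  let ?D = "C \<union> x ` M"
  have D: "?D \<in> \<I>" by (rule Un_convergent_in_ideal[OF X I C x M conv])
  then have D': "compactin X ?D" using I by (auto simp: compact_ideal_def)
  have cf: "continuous_map X Y f" using f by (simp add: cont_maps_def)
  have "\<exists>V. openin Y V \<and> f z \<in> V \<and> finite {n \<in> M. \<alpha> n (x n) \<in> V}" if z: "z \<in> ?D" for z
  proof -
    have "f z \<in> U" using z U fx by auto
    from pytkeev_avoiding_sequence[OF P U(1) this, of M "\<lambda>n. \<alpha> n (x n)"] avoid
    show ?thesis by metis
  qed
  then obtain V where V: "\<And>z. z \<in> ?D \<Longrightarrow>
      openin Y (V z) \<and> f z \<in> V z \<and> finite {n \<in> M. \<alpha> n (x n) \<in> V z}"
    by metis
  define G where "G = (\<lambda>z. {u \<in> topspace X. f u \<in> V z})"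
  have G: "openin X (G z) \<and> z \<in> G z" if "z \<in> ?D" for z
    using openin_continuous_map_preimage[OF cf] V[OF that] that compactin_subset_topspace[OF D']
    by (auto simp: G_def)
  obtain T E where T: "finite T" "T \<subseteq> ?D" "?D \<subseteq> (\<Union>t\<in>T. E t)"
    and E: "\<And>t. t \<in> T \<Longrightarrow> compactin X (E t) \<and> E t \<subseteq> G t \<inter> ?D"
    using compact_finite_refinement[OF X D' G] by metis
  define S where "S = (\<lambda>t. (E t, V t)) ` T"
  have EI: "E t \<in> \<I>" if "t \<in> T" for t
  proof -
    have "?D \<inter> E t \<in> \<I>" using I(1) D E[OF that] unfolding compact_ideal_def by blast
    moreover have "?D \<inter> E t = E t" using E[OF that] by blast
    ultimately show ?thesis by simp
  qed
  have "{n \<in> M. \<alpha> n \<in> box_maps X Y S} \<subseteq> (\<Union>t\<in>T. {n \<in> M. \<alpha> n (x n) \<in> V t})"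
    using T(3) by (fastforce simp: box_maps_def S_def)
  moreover have "finite (\<Union>t\<in>T. {n \<in> M. \<alpha> n (x n) \<in> V t})" using T V by blast
  ultimately have "finite {n \<in> M. \<alpha> n \<in> box_maps X Y S}" by (rule finite_subset)
  moreover have "f \<in> box_maps X Y S"
    using f E by (force simp: box_maps_def S_def G_def)
  moreover have "finite S" "S \<subseteq> \<I> \<times> Collect (openin Y)"
    using T V EI by (auto simp: S_def)
  ultimately show ?thesis by blast
qed

text \<open>
  Take for \<open>J n\<close> the largest \<open>j \<le> n\<close> with \<open>Q j n\<close>. Passing to a subsequence of \<open>n\<close> instead would not do
  for the application, since the sequence must keep entering every neighbourhood of \<open>f\<close>.
\<close>

lemma diagonal_index:
  fixes Q :: "nat \<Rightarrow> nat \<Rightarrow> bool"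
  assumes "\<And>j. eventually (Q j) sequentially"
  obtains J where "filterlim J at_top sequentially" "eventually (\<lambda>n. Q (J n) n) sequentially"
proof
  \<comment> \<open>The default \<open>0\<close> keeps the maximum defined; \<open>Q 0 n\<close> holds for almost all \<open>n\<close> anyway.\<close>
  define J where "J = (\<lambda>n. Max (insert 0 {j. j \<le> n \<and> Q j n}))"
  have fin: "finite {j. j \<le> n \<and> Q j n}" for n by simp
  show "filterlim J at_top sequentially"
    unfolding filterlim_at_top
  proof
    fix k
    show "eventually (\<lambda>n. k \<le> J n) sequentially"
      using assms[of k] eventually_ge_at_top[of k]
      by eventually_elim (use fin in \<open>auto simp: J_def intro!: Max_ge\<close>)
  qed
  show "eventually (\<lambda>n. Q (J n) n) sequentially"
    using assms[of 0]
  proof eventually_elim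
    case (elim n)
    have "J n \<in> insert 0 {j. j \<le> n \<and> Q j n}" unfolding J_def using fin by (intro Max_in) auto
    then show ?case using elim by auto
  qed
qed

definition network_boxes ::
  "'a topology \<Rightarrow> 'b topology \<Rightarrow> 'a set set \<Rightarrow> 'b set set \<Rightarrow> ('a \<Rightarrow> 'b) set set" where
  "network_boxes X Y \<N> \<P> = box_maps X Y `
     {S. finite S \<and> S \<subseteq> finite_inters (finite_unions \<N>) \<times> finite_unions \<P>}"

lemma countable_network_boxes:
  "\<lbrakk>countable \<N>; countable \<P>\<rbrakk> \<Longrightarrow> countable (network_boxes X Y \<N> \<P>)"
  unfolding network_boxes_def
  by (simp add: countable_Collect_finite_subset countable_finite_inters countable_finite_unions)

text \<open>
  For constant \<open>\<alpha>\<close> this says that the boxes form a network at \<open>f\<close>, and for injective \<open>\<alpha>\<close> that they catch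
  infinitely many members of a countable set accumulating at \<open>f\<close>. Counting indices instead of
  functions treats both cases at once.
\<close>

lemma frequently_in_network_box:
  assumes X: "Hausdorff_space X" and I: "compact_ideal X \<I>" "discretely_complete X \<I>"
    and N: "countable \<N>" "k_network X \<N>" and P: "countable \<P>" "pytkeev_network Y \<P>"
    and V: "nbhd_in (ideal_open_topology X \<I> Y) f V"
    and \<alpha>: "\<And>n::nat. \<alpha> n \<in> cont_maps X Y"
    and freq: "\<And>W. nbhd_in (ideal_open_topology X \<I> Y) f W \<Longrightarrow> infinite {n. \<alpha> n \<in> W}"
  shows "\<exists>F \<in> network_boxes X Y \<N> \<P>. F \<subseteq> V \<and> infinite {n. \<alpha> n \<in> F}"
proof (rule ccontr)
  assume no: "\<not> ?thesis"
  obtain W where W: "openin (ideal_open_topology X \<I> Y) W" "f \<in> W" "W \<subseteq> V"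
    using V by (auto simp: nbhd_in_def)
  then obtain S where S: "finite S" "S \<subseteq> \<I> \<times> Collect (openin Y)" and fS: "f \<in> box_maps X Y S"
    and SV: "box_maps X Y S \<subseteq> V"
    using ideal_open_nbhd_base[OF W(1,2)] by blast
  have f: "f \<in> cont_maps X Y" using fS box_maps_subset by blast
  then have cf: "continuous_map X Y f" by (simp add: cont_maps_def)
  define G where "G = (\<lambda>s :: 'a set \<times> 'b set. {u \<in> topspace X. f u \<in> snd s})"
  have s: "fst s \<in> \<I>" "compactin X (fst s)" "openin Y (snd s)" "f ` fst s \<subseteq> snd s"
      "openin X (G s)" "fst s \<subseteq> G s" if "s \<in> S" for s
  proof -
    show *: "fst s \<in> \<I>" "openin Y (snd s)" "f ` fst s \<subseteq> snd s"
      using that S fS by (auto simp: box_maps_def)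
    then show c: "compactin X (fst s)" using I by (auto simp: compact_ideal_def)
    show "openin X (G s)" unfolding G_def using openin_continuous_map_preimage[OF cf] * by blast
    show "fst s \<subseteq> G s" unfolding G_def using * compactin_subset_topspace[OF c] by auto
  qed
  have "\<exists>K. range K \<subseteq> finite_inters (finite_unions \<N>) \<and> (\<forall>j::nat. fst s \<subseteq> K j \<and> K j \<subseteq> G s) \<and>
    (\<forall>W. openin X W \<longrightarrow> fst s \<subseteq> W \<longrightarrow> eventually (\<lambda>j. K j \<subseteq> W) sequentially)" if "s \<in> S" for s
    using outer_approximation[OF N(2,1) s(2,5,6)[OF that]] by metis
  then obtain K where K: "\<And>s. s \<in> S \<Longrightarrow>
    range (K s) \<subseteq> finite_inters (finite_unions \<N>) \<and> (\<forall>j::nat. fst s \<subseteq> K s j \<and> K s j \<subseteq> G s) \<and>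
    (\<forall>W. openin X W \<longrightarrow> fst s \<subseteq> W \<longrightarrow> eventually (\<lambda>j. K s j \<subseteq> W) sequentially)"
    by metis
  have "\<exists>L. range L \<subseteq> finite_unions \<P> \<and> (\<forall>j::nat. L j \<subseteq> snd s) \<and>
    (\<forall>N\<in>\<P>. N \<subseteq> snd s \<longrightarrow> eventually (\<lambda>j. N \<subseteq> L j) sequentially)" for s :: "'a set \<times> 'b set"
    using inner_approximation[OF P(1), of "snd s"] by metis
  then obtain L where L: "\<And>s :: 'a set \<times> 'b set.
    range (L s) \<subseteq> finite_unions \<P> \<and> (\<forall>j::nat. L s j \<subseteq> snd s) \<and>
    (\<forall>N\<in>\<P>. N \<subseteq> snd s \<longrightarrow> eventually (\<lambda>j. N \<subseteq> L s j) sequentially)"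
    by metis
  \<comment> \<open>Since \<open>fst s \<subseteq> K s j\<close> and \<open>L s j \<subseteq> snd s\<close>, every \<open>F j\<close> refines the chosen basic neighbourhood.\<close>
  define F where "F = (\<lambda>j. box_maps X Y ((\<lambda>s. (K s j, L s j)) ` S))"
  have F: "F j \<in> network_boxes X Y \<N> \<P>" "F j \<subseteq> V" for j
  proof -
    have "(K s j, L s j) \<in> finite_inters (finite_unions \<N>) \<times> finite_unions \<P>" if "s \<in> S" for s
      using K[OF that] L[of s] by (simp add: image_subset_iff)
    then have "(\<lambda>s. (K s j, L s j)) ` S \<subseteq> finite_inters (finite_unions \<N>) \<times> finite_unions \<P>"
      by (simp add: image_subset_iff)
    then show "F j \<in> network_boxes X Y \<N> \<P>"
      unfolding F_def network_boxes_def using S(1) by simp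
    have "F j \<subseteq> box_maps X Y S"
    proof
      fix g assume g: "g \<in> F j"
      have "g ` fst s \<subseteq> snd s" if "s \<in> S" for s
      proof -
        have "g ` K s j \<subseteq> L s j" using g that by (auto simp: F_def box_maps_def)
        moreover have "fst s \<subseteq> K s j" "L s j \<subseteq> snd s" using K[OF that] L[of s] by simp_all
        ultimately show ?thesis by blast
      qed
      moreover have "g \<in> cont_maps X Y" using g by (simp add: F_def box_maps_def)
      ultimately show "g \<in> box_maps X Y S" by (simp add: box_maps_def)
    qed
    then show "F j \<subseteq> V" using SV by blast
  qed
  have "eventually (\<lambda>n. \<alpha> n \<notin> F j) sequentially" for j
  proof -
    have "finite {n. \<alpha> n \<in> F j}" using no F[of j] by meson
    then show ?thesis by (simp add: eventually_cofinite flip: cofinite_eq_sequentially)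
  qed
  then obtain J where J: "filterlim J at_top sequentially"
    and notF: "eventually (\<lambda>n. \<alpha> n \<notin> F (J n)) sequentially"
    using diagonal_index[of "\<lambda>j n. \<alpha> n \<notin> F j"] by metis
  define M where "M = {n. \<alpha> n \<notin> F (J n)}"
  have cofM: "finite (- M)"
    using notF by (simp add: M_def Compl_eq eventually_cofinite flip: cofinite_eq_sequentially)
  have "\<exists>s u. s \<in> S \<and> u \<in> K s (J n) \<and> \<alpha> n u \<notin> L s (J n)" if "n \<in> M" for n
    using that \<alpha>[of n] by (auto simp: M_def F_def box_maps_def)
  then obtain \<sigma> x where \<sigma>x: "\<And>n. n \<in> M \<Longrightarrow>
      \<sigma> n \<in> S \<and> x n \<in> K (\<sigma> n) (J n) \<and> \<alpha> n (x n) \<notin> L (\<sigma> n) (J n)"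
    by metis
  \<comment> \<open>The indices are split according to the pair \<open>s\<close> that \<open>\<alpha> n\<close> violates. As \<open>J\<close> tends to infinity, the
    points \<open>x n\<close> converge to \<open>fst s\<close>, and each \<open>N \<subseteq> snd s\<close> in \<open>\<P>\<close> is eventually absorbed by
    \<open>L s (J n)\<close> and so avoided by \<open>\<alpha> n (x n)\<close>.\<close>
  have "\<exists>T. finite T \<and> T \<subseteq> \<I> \<times> Collect (openin Y) \<and> f \<in> box_maps X Y T \<and>
      finite {n \<in> {n \<in> M. \<sigma> n = s}. \<alpha> n \<in> box_maps X Y T}" if sS: "s \<in> S" for s
  proof (rule separating_box[OF X I P(2) f s(1,3,4)[OF sS], where x = x])
    have xG: "x n \<in> G s" if "n \<in> M" "\<sigma> n = s" for n using \<sigma>x[OF that(1)] K[OF sS] that by blast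
    show "x ` {n \<in> M. \<sigma> n = s} \<subseteq> topspace X" using xG by (auto simp: G_def)
    show "f (x n) \<in> snd s" if "n \<in> {n \<in> M. \<sigma> n = s}" for n using xG that by (auto simp: G_def)
    show "finite {n \<in> {n \<in> M. \<sigma> n = s}. x n \<notin> W}" if W: "openin X W" "fst s \<subseteq> W" for W
    proof -
      have "eventually (\<lambda>j. K s j \<subseteq> W) sequentially" using K[OF sS] W by blast
      then have "eventually (\<lambda>n. K s (J n) \<subseteq> W) sequentially"
        using J by (rule eventually_compose_filterlim)
      then have "finite {n. \<not> K s (J n) \<subseteq> W}"
        by (simp add: eventually_cofinite flip: cofinite_eq_sequentially)
      then show ?thesis by (rule finite_subset[rotated]) (use \<sigma>x in blast)
    qed
    show "finite {n \<in> {n \<in> M. \<sigma> n = s}. \<alpha> n (x n) \<in> N}" if "N \<in> \<P>" "N \<subseteq> snd s" for N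
    proof -
      have "eventually (\<lambda>j. N \<subseteq> L s j) sequentially" using L[of s] that by blast
      then have "eventually (\<lambda>n. N \<subseteq> L s (J n)) sequentially"
        using J by (rule eventually_compose_filterlim)
      then have "finite {n. \<not> N \<subseteq> L s (J n)}"
        by (simp add: eventually_cofinite flip: cofinite_eq_sequentially)
      then show ?thesis by (rule finite_subset[rotated]) (use \<sigma>x in blast)
    qed
  qed simp
  then have "\<forall>s\<in>S. \<exists>T. finite T \<and> T \<subseteq> \<I> \<times> Collect (openin Y) \<and> f \<in> box_maps X Y T \<and>
      finite {n \<in> {n \<in> M. \<sigma> n = s}. \<alpha> n \<in> box_maps X Y T}"
    by blast
  from bchoice[OF this] obtain T where T: "\<And>s. s \<in> S \<Longrightarrow>
      finite (T s) \<and> T s \<subseteq> \<I> \<times> Collect (openin Y) \<and> f \<in> box_maps X Y (T s) \<and>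
      finite {n \<in> {n \<in> M. \<sigma> n = s}. \<alpha> n \<in> box_maps X Y (T s)}"
    by blast
  define R where "R = (\<Union>s\<in>S. T s)"
  have "finite R" "R \<subseteq> \<I> \<times> Collect (openin Y)" using S T unfolding R_def by blast+
  then have "openin (ideal_open_topology X \<I> Y) (box_maps X Y R)" by (rule openin_box_maps)
  moreover have "f \<in> box_maps X Y R" using f T by (fastforce simp: R_def box_maps_def)
  ultimately have "nbhd_in (ideal_open_topology X \<I> Y) f (box_maps X Y R)"
    using box_maps_subset by (auto simp: nbhd_in_def)
  then have "infinite {n. \<alpha> n \<in> box_maps X Y R}" by (rule freq)
  moreover have "{n. \<alpha> n \<in> box_maps X Y R} \<subseteq>
      - M \<union> (\<Union>s\<in>S. {n \<in> {n \<in> M. \<sigma> n = s}. \<alpha> n \<in> box_maps X Y (T s)})"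
    using \<sigma>x by (fastforce simp: R_def box_maps_def)
  moreover have "finite (- M \<union> (\<Union>s\<in>S. {n \<in> {n \<in> M. \<sigma> n = s}. \<alpha> n \<in> box_maps X Y (T s)}))"
    using cofM S(1) T by blast
  ultimately show False using finite_subset by blast
qed

section \<open>Networks reduce accumulation to countable sets\<close>

text \<open>
  From each member of the network keep its whole trace on \<open>A\<close> if that is finite, and a countably infinite
  part of it otherwise. An open set is a union of members of the network: either one of them has an
  infinite trace, or nothing of \<open>A\<close> in the open set has been discarded.
\<close>

lemma accumulates_at_countable_subset:
  assumes N: "countable \<N>" "\<And>z. z \<in> topspace Z \<Longrightarrow> network_at Z \<N> z"
    and A: "accumulates_at Z A f"
  obtains B where "B \<subseteq> A" "countable B" "accumulates_at Z B f"
proof -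
  have "\<exists>B. B \<subseteq> N \<inter> A \<and> countable B \<and> (if finite (N \<inter> A) then B = N \<inter> A else infinite B)" for N
  proof (cases "finite (N \<inter> A)")
    case True
    then show ?thesis by (intro exI[of _ "N \<inter> A"]) (simp add: countable_finite)
  next
    case False
    then obtain B where "B \<subseteq> N \<inter> A" "countable B" "infinite B"
      using infinite_countable_subset'[of "N \<inter> A"] by blast
    then show ?thesis using False by (intro exI[of _ B]) simp
  qed
  then obtain b where b: "\<And>N :: 'a set. b N \<subseteq> N \<inter> A \<and> countable (b N) \<and>
      (if finite (N \<inter> A) then b N = N \<inter> A else infinite (b N))"
    by metis
  define B where "B = (\<Union>N\<in>\<N>. b N)"
  have BA: "B \<subseteq> A" using b by (auto simp: B_def)
  have "infinite (V \<inter> B)" if V: "nbhd_in Z f V" for V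
  proof
    assume fin: "finite (V \<inter> B)"
    obtain W where W: "openin Z W" "f \<in> W" "W \<subseteq> V" using V by (auto simp: nbhd_in_def)
    have "nbhd_in Z f W" using W openin_subset by (auto simp: nbhd_in_def)
    then have inf: "infinite (W \<inter> A)" using A by (auto simp: accumulates_at_def)
    have "z \<in> V \<inter> B" if z: "z \<in> W \<inter> A" for z
    proof -
      have "nbhd_in Z z W" "z \<in> topspace Z" using W z openin_subset by (auto simp: nbhd_in_def)
      then obtain N where N: "N \<in> \<N>" "z \<in> N" "N \<subseteq> W"
        using assms(2) unfolding network_at_def by meson
      have "b N \<subseteq> V \<inter> B" using N b[of N] W by (auto simp: B_def)
      then have "finite (b N)" using fin finite_subset by blast
      then have "b N = N \<inter> A" using b[of N] by (auto split: if_splits)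
      then show ?thesis using N z \<open>b N \<subseteq> V \<inter> B\<close> by blast
    qed
    then have "W \<inter> A \<subseteq> V \<inter> B" by blast
    then show False using inf fin finite_subset by blast
  qed
  then have "accumulates_at Z B f" using A BA by (auto simp: accumulates_at_def)
  moreover have "countable B" unfolding B_def using N(1) b by (intro countable_UN) auto
  ultimately show ?thesis using that BA by blast
qed

theorem theorem2p2:
  fixes X :: "'a topology" and Y :: "'b topology" and \<I> :: "'a set set"
  assumes "Hausdorff_space X"
    and "\<exists>\<N>. countable \<N> \<and> k_network X \<N>"
    and "compact_ideal X \<I>"
    and "discretely_complete X \<I>"
    and "\<exists>\<P>. countable \<P> \<and> pytkeev_network Y \<P>"
  shows "\<exists>\<P>. countable \<P> \<and> pytkeev_network (ideal_open_topology X \<I> Y) \<P>"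
proof -
  obtain \<N> where N: "countable \<N>" "k_network X \<N>" using assms(2) by blast
  obtain \<P> where P: "countable \<P>" "pytkeev_network Y \<P>" using assms(5) by blast
  let ?Z = "ideal_open_topology X \<I> Y" and ?B = "network_boxes X Y \<N> \<P>"
  note box = frequently_in_network_box[OF assms(1,3,4) N P]
  have cB: "countable ?B" using countable_network_boxes N P by blast
  have sub: "?B \<subseteq> Pow (topspace ?Z)" using box_maps_subset by (auto simp: network_boxes_def)
  have net: "network_at ?Z ?B f" if f: "f \<in> topspace ?Z" for f
    unfolding network_at_def
  proof (intro conjI allI impI sub f)
    fix V assume V: "nbhd_in ?Z f V"
    have "infinite {n::nat. f \<in> W}" if "nbhd_in ?Z f W" for W
      using that by (auto simp: nbhd_in_def)
    then obtain F where F: "F \<in> ?B" "F \<subseteq> V" "infinite {n::nat. f \<in> F}"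
      using box[OF V, of "\<lambda>_. f"] f by auto
    have "f \<in> F" using F(3) by (rule contrapos_np) simp
    then show "\<exists>F\<in>?B. f \<in> F \<and> F \<subseteq> V" using F by blast
  qed
  have "pytkeev_network_at ?Z ?B f" if f: "f \<in> topspace ?Z" for f
    unfolding pytkeev_network_at_def
  proof (intro conjI allI impI net f)
    fix V A assume VA: "nbhd_in ?Z f V \<and> accumulates_at ?Z A f"
    obtain A' where A': "A' \<subseteq> A" "countable A'" "accumulates_at ?Z A' f"
      using accumulates_at_countable_subset[OF cB net] VA by blast
    have infA': "infinite (W \<inter> A')" if "nbhd_in ?Z f W" for W
      using A'(3) that by (simp add: accumulates_at_def)
    then have "infinite A'" using VA by blast
    then have bij: "bij_betw (from_nat_into A') UNIV A'" using A'(2) by (rule bij_betw_from_nat_into[rotated])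
    let ?\<alpha> = "from_nat_into A'"
    have hits: "W \<inter> A' = ?\<alpha> ` {n. ?\<alpha> n \<in> W}" for W
      using bij by (force simp: bij_betw_def)
    have "infinite {n. ?\<alpha> n \<in> W}" if "nbhd_in ?Z f W" for W
      using infA'[OF that] hits by fastforce
    moreover have "?\<alpha> n \<in> cont_maps X Y" for n
      using A'(3) bij by (auto simp: accumulates_at_def bij_betw_def)
    ultimately obtain F where F: "F \<in> ?B" "F \<subseteq> V" "infinite {n. ?\<alpha> n \<in> F}"
      using box[of f V ?\<alpha>] VA by blast
    have "inj_on ?\<alpha> {n. ?\<alpha> n \<in> F}" using bij by (auto simp: bij_betw_def inj_on_def)
    then have "infinite (F \<inter> A')" using F(3) hits[of F] by (simp add: finite_image_iff)
    then have "infinite (F \<inter> A)" using A'(1) by (meson Int_mono finite_subset order_refl)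
    then show "\<exists>F\<in>?B. F \<subseteq> V \<and> infinite (F \<inter> A)" using F by blast
  qed
  then show ?thesis using cB sub unfolding pytkeev_network_def by blast
qed

end
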